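(* Let $A(\lambda)=I_n\lambda^r+\sum_{i=1}^r A_i\lambda^{r-i}$ and $B(\lambda)=I_n\lambda^r+\sum_{i=1}^r B_i\lambda^{r-i}$ be $n\times n$ monic matrix polynomials of degree $r$ over the field of complex numbers $\mathbb C$. Suppose they are equivalent, with common Smith normal form $S(\lambda)=\operatorname{diag}(s_1(\lambda),\dots,s_{n-1}(\lambda),s_n(\lambda))$. Let $$D(\lambda)=\Bigl(\bigl(s_1(\lambda)s_2(\lambda)\cdots s_{n-1}(\lambda)\bigr)^{-1}B^*(\lambda)\Bigr)\otimes A^T(\lambda)\in M_{n^2,n^2}(\mathbb C[\lambda]).$$ Then the families $\mathbf A=\{A_1,A_2,\dots,A_r\}$ and $\mathbf B=\{B_1,B_2,\dots,B_r\}$ are similar over $\mathbb C$ if and only if $\operatorname{rank} M[D,s_n]<n^2$ and the homogeneous system of linear equations $M[D,s_n]\,x=\bar 0$ has a solution $x=[v_1,v_2,\dots,v_{n^2}]^T$ over $\mathbb C$ such that the matrix $$V=\begin{bmatrix} v_1 & v_2 & \cdots & v_n\\ v_{n+1} & v_{n+2} & \cdots & v_{2n}\\ \vdots & \vdots & & \vdots\\ v_{n^2-n+1} & v_{n^2-n+2} & \cdots & v_{n^2}\end{bmatrix}$$ is nonsingular. Moreover, if $x$ is a solution of $M[D,s_n]x=\bar 0$ over $\mathbb C$ whose associated matrix $V$ satisfies $\det V\ne 0$, then $A_i=V^{-1}B_iV$ for all $i=1,2,\dots,r$.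
   Context: Two families (ordered lists) $\mathbf A=\{A_1,\dots,A_r\}$ and $\mathbf B=\{B_1,\dots,B_r\}$ of $n\times n$ matrices over $\mathbb C$ are similar if there exists $T\in GL(n,\mathbb C)$ such that $A_i=TB_iT^{-1}$ for all $i=1,\dots,r$. $M_{m,n}(R)$ is the set of $m\times n$ matrices over a ring $R$ and $GL(n,R)$ the group of invertible $n\times n$ matrices over $R$. Matrices $A(\lambda),B(\lambda)\in M_{n,n}(\mathbb C[\lambda])$ are equivalent if $A(\lambda)=P(\lambda)B(\lambda)Q(\lambda)$ for some $P(\lambda),Q(\lambda)\in GL(n,\mathbb C[\lambda])$. The Smith normal form of a matrix $A(\lambda)$ with $\det A(\lambda)\neq 0$ is the diagonal matrix $\operatorname{diag}(s_1(\lambda),\dots,s_n(\lambda))$ equivalent to $A(\lambda)$ with all $s_i(\lambda)$ monic and $s_1(\lambda)\mid s_2(\lambda)\mid\cdots\mid s_n(\lambda)$. $B^*(\lambda)$ denotes the classical adjoint (adjugate) of $B(\lambda)$, and $A^T(\lambda)$ the transpose of $A(\lambda)$. The adjugate $B^*(\lambda)$ is entrywise divisible by $s_1(\lambda)\cdots s_{n-1}(\lambda)$, so $D(\lambda)$ is a polynomial matrix. The Kronecker product of $X=[x_{ij}]$ and $Y$ is the block matrix $X\otimes Y=[x_{ij}Y]$. For $G(\lambda)\in M_{m,p}(\mathbb C[\lambda])$, $G^{(k)}(\lambda)$ denotes its entrywise $k$-th formal derivative. For a monic polynomial $b(\lambda)=(\lambda-\beta_1)^{k_1}\cdots(\lambda-\beta_q)^{k_q}$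 with pairwise distinct $\beta_j\in\mathbb C$ (listed in some fixed order), positive integers $k_j$, and degree $k=k_1+\cdots+k_q$, define $$M[G,b]=\begin{bmatrix}N_1\\ \vdots\\ N_q\end{bmatrix}\in M_{mk,p}(\mathbb C),\qquad N_j=\begin{bmatrix}G(\beta_j)\\ G^{(1)}(\beta_j)\\ \vdots\\ G^{(k_j-1)}(\beta_j)\end{bmatrix}\in M_{mk_j,p}(\mathbb C).$$ *)

theory Defs
  imports
    "HOL-Computational_Algebra.Computational_Algebra"
    "Jordan_Normal_Form.Determinant"
    "Jordan_Normal_Form.Gauss_Jordan_Elimination"
    "Jordan_Normal_Form.DL_Rank"
begin

definition GL :: "nat \<Rightarrow> 'a :: comm_ring_1 mat set" where
  "GL n = {P \<in> carrier_mat n n. invertible_mat P}"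

text \<open>Total inverse on top of \<^const>\<open>mat_inverse\<close>; meaningful only on invertible matrices.\<close>

abbreviation mat_inv :: "'a :: field mat \<Rightarrow> 'a mat" where
  "mat_inv A \<equiv> the (mat_inverse A)"

definition similar_families :: "nat \<Rightarrow> nat \<Rightarrow> (nat \<Rightarrow> complex mat) \<Rightarrow> (nat \<Rightarrow> complex mat) \<Rightarrow> bool" where
  "similar_families n r A B \<longleftrightarrow> (\<exists>T \<in> GL n. \<forall>i\<in>{1..r}. A i = T * B i * mat_inv T)"

definition equivalent_mats :: "nat \<Rightarrow> complex poly mat \<Rightarrow> complex poly mat \<Rightarrow> bool" where
  "equivalent_mats n A B \<longleftrightarrow> (\<exists>P \<in> GL n. \<exists>Q \<in> GL n. A = P * B * Q)"

definition smith_normal_form :: "nat \<Rightarrow> complex poly mat \<Rightarrow> complex poly mat \<Rightarrow> bool" where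
  "smith_normal_form n A S \<longleftrightarrow>
     S \<in> carrier_mat n n \<and> diagonal_mat S \<and> equivalent_mats n A S \<and>
     (\<forall>i<n. lead_coeff (S $$ (i,i)) = 1) \<and>
     (\<forall>i. Suc i < n \<longrightarrow> S $$ (i,i) dvd S $$ (Suc i, Suc i))"

text \<open>The polynomial matrix \<open>I\<^sub>n \<lambda>\<^sup>r + A\<^sub>1 \<lambda>\<^sup>r\<^sup>-\<^sup>1 + \<dots> + A\<^sub>r\<close>.\<close>

definition monic_matpoly :: "nat \<Rightarrow> nat \<Rightarrow> (nat \<Rightarrow> complex mat) \<Rightarrow> complex poly mat" where
  "monic_matpoly n r A = mat n n (\<lambda>(i,j).
     monom (1\<^sub>m n $$ (i,j)) r + (\<Sum>k=1..r. monom (A k $$ (i,j)) (r - k)))"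

definition kronecker :: "'a :: times mat \<Rightarrow> 'a mat \<Rightarrow> 'a mat" where
  "kronecker X Y = mat (dim_row X * dim_row Y) (dim_col X * dim_col Y) (\<lambda>(i,j).
     X $$ (i div dim_row Y, j div dim_col Y) * Y $$ (i mod dim_row Y, j mod dim_col Y))"

text \<open>
  The entrywise \<open>div\<close> is an exact division here: the product of the first \<open>n - 1\<close>
  invariant factors of \<open>B\<close> divides every entry of the adjugate of \<open>B\<close>.
\<close>

definition D_mat :: "nat \<Rightarrow> complex poly mat \<Rightarrow> complex poly mat \<Rightarrow> complex poly mat \<Rightarrow> complex poly mat" where
  "D_mat n S A B =
     kronecker (map_mat (\<lambda>f. f div (\<Prod>i<n-1. S $$ (i,i))) (adj_mat B)) (transpose_mat A)"

text \<open>
  A listing \<open>[(\<beta>\<^sub>1,k\<^sub>1),\<dots>,(\<beta>\<^sub>q,k\<^sub>q)]\<close> of the distinct roots with multiplicities, in some order.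
  It exists for every monic \<open>b\<close>, and the order is the only freedom.
\<close>

definition root_listing :: "complex poly \<Rightarrow> (complex \<times> nat) list \<Rightarrow> bool" where
  "root_listing b bs \<longleftrightarrow>
     distinct (map fst bs) \<and> (\<forall>(\<beta>,k)\<in>set bs. 0 < k) \<and>
     b = (\<Prod>(\<beta>,k)\<leftarrow>bs. [:-\<beta>, 1:] ^ k)"

lemma root_listing_exists:
  assumes "lead_coeff b = 1"
  shows "\<exists>bs. root_listing b bs"
proof -
  have nz: "b \<noteq> 0" using assms by auto
  then obtain zs where zs: "set zs = {z. poly b z = 0}" "distinct zs"
    using finite_distinct_list[OF poly_roots_finite[OF nz]] by auto
  have "b = (\<Prod>z\<in>set zs. [:-z, 1:] ^ Polynomial.order z b)"
    using complex_poly_decompose[of b] assms zs(1) by simp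
  then have "b = (\<Prod>z\<leftarrow>zs. [:-z, 1:] ^ Polynomial.order z b)"
    using zs(2) by (simp add: prod.distinct_set_conv_list)
  then have "root_listing b (map (\<lambda>z. (z, Polynomial.order z b)) zs)"
    using zs nz by (auto simp: root_listing_def o_def Polynomial.order_root)
  then show ?thesis by blast
qed

text \<open>The matrix \<open>M[G,b]\<close>, where \<open>b\<close> is given through one of its root listings.\<close>

definition M_mat :: "complex poly mat \<Rightarrow> (complex \<times> nat) list \<Rightarrow> complex mat" where
  "M_mat G bs = mat_of_rows (dim_col G)
     (concat (map (\<lambda>(\<beta>,k).
        concat (map (\<lambda>l. rows (map_mat (\<lambda>f. poly ((pderiv ^^ l) f) \<beta>) G)) [0..<k])) bs))"

abbreviation mat_rank :: "complex mat \<Rightarrow> nat" where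
  "mat_rank A \<equiv> vec_space.rank (dim_row A) A"

text \<open>The \<open>n \<times> n\<close> matrix filled row by row with the entries of a vector of length \<open>n\<^sup>2\<close>.\<close>

definition V_mat :: "nat \<Rightarrow> complex vec \<Rightarrow> complex mat" where
  "V_mat n x = mat n n (\<lambda>(i,j). x $ (i * n + j))"

definition hom_solution :: "complex mat \<Rightarrow> complex vec \<Rightarrow> bool" where
  "hom_solution M x \<longleftrightarrow> x \<in> carrier_vec (dim_col M) \<and> M *\<^sub>v x = 0\<^sub>v (dim_row M)"

end

theory Submission
  imports Defs "HOL-Computational_Algebra.Field_as_Ring"
begin

text \<open>
  Two families are similar iff some nonsingular constant matrix \<open>V\<close> intertwines them, in the sense
  that \<open>V A\<^sub>i = B\<^sub>i V\<close> for all \<open>i\<close>. The linear system \<open>M[D,s\<^sub>n] x = 0\<close> describes the space of all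
  intertwining matrices \<open>V\<close>, where \<open>x\<close> lists the entries of \<open>V\<close> row by row.

  To see this, let \<open>C\<close> be the adjugate of \<open>B(\<lambda>)\<close> divided by \<open>s\<^sub>1 \<dots> s\<^sub>n\<^sub>-\<^sub>1\<close>. Since
  \<open>det B(\<lambda>) = s\<^sub>1 \<dots> s\<^sub>n\<close> up to a unit, \<open>C\<close> is \<open>s\<^sub>n B(\<lambda>)\<inverse>\<close> up to a unit
  (\<open>smith_adjugate_factorisation\<close>). As \<open>D = C \<otimes> A\<^sup>T\<close>, the vector \<open>D x\<close> lists the entries of
  \<open>C V A(\<lambda>)\<close> (\<open>kronecker_transpose_row_product\<close>), and \<open>M[D,s\<^sub>n] x = 0\<close> says that \<open>s\<^sub>n\<close> divides all of them
  (\<open>hom_solution_M_mat_iff_dvd\<close>). By the description of \<open>C\<close> this means that \<open>V A(\<lambda>) = B(\<lambda>) W(\<lambda>)\<close>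
  for some matrix polynomial \<open>W\<close> (\<open>entries_dvd_iff_left_factor\<close>). Both \<open>A(\<lambda>)\<close> and \<open>B(\<lambda>)\<close> are
  monic of degree \<open>r\<close>, so comparing degrees gives \<open>W = V\<close>, and comparing coefficients gives
  \<open>V A\<^sub>i = B\<^sub>i V\<close> (\<open>left_divides_iff_intertwines\<close>).

  A nonsingular \<open>V\<close> is nonzero because \<open>n \<ge> 1\<close>, so it gives a nonzero kernel vector of \<open>M[D,s\<^sub>n]\<close>,
  and the rank lies below the number \<open>n\<^sup>2\<close> of columns (\<open>rank_less_if_kernel_nontrivial\<close>).
\<close>

section \<open>Rank and inverses\<close>

text \<open>
  The rank is the size of a maximal independent \<^emph>\<open>set\<close> of columns, so a repeated column has to be
  excluded before a nontrivial kernel vector can be read as a linear dependence: if the rank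
  equals the number of columns, then the set of columns has that many elements.
\<close>

lemma rank_less_if_kernel_nontrivial:
  fixes A :: "'a::field mat"
  assumes A: "A \<in> carrier_mat m k" and v: "v \<in> carrier_vec k" "v \<noteq> 0\<^sub>v k" "A *\<^sub>v v = 0\<^sub>v m"
  shows "vec_space.rank m A < k"
proof -
  interpret vec_space "TYPE('a)" m .
  have "rank A \<noteq> k"
  proof
    assume full: "rank A = k"
    obtain S where S: "maximal S (\<lambda>T. T \<subseteq> set (cols A) \<and> lin_indpt T)"
      using maximal_exists_superset[of "set (cols A)" "\<lambda>T. T \<subseteq> set (cols A) \<and> lin_indpt T" "{}"]
      by (auto simp: lin_dep_def)
    have "S \<subseteq> set (cols A)" using S by (simp add: maximal_def)
    then have "rank A \<le> card (set (cols A))"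
      using rank_card_indpt[OF A S] by (simp add: card_mono)
    then have "length (cols A) \<le> card (set (cols A))" using A full by simp
    then have "distinct (cols A)" using card_length[of "cols A"] by (intro card_distinct) simp
    then show False using lin_depI[OF A v] full_rank_lin_indpt[OF A full] by blast
  qed
  then show ?thesis using rank_le_nc[OF A] by simp
qed

lemma GL_obtain_inverse:
  assumes "P \<in> GL n"
  obtains P' where "P' \<in> carrier_mat n n" "P * P' = 1\<^sub>m n" "P' * P = 1\<^sub>m n"
proof -
  have P: "P \<in> carrier_mat n n" and "invertible_mat P" using assms by (auto simp: GL_def)
  then obtain P' where inv: "P * P' = 1\<^sub>m (dim_row P)" "P' * P = 1\<^sub>m (dim_row P')"
    by (auto simp: invertible_mat_def inverts_mat_def)
  have "dim_col P' = n" using arg_cong[OF inv(1), of dim_col] P by simp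
  moreover have "dim_row P' = n" using arg_cong[OF inv(2), of dim_col] P by simp
  ultimately show thesis using that inv P by auto
qed

lemma invertible_matI:
  assumes "A \<in> carrier_mat n n" "B \<in> carrier_mat n n" "A * B = 1\<^sub>m n" "B * A = 1\<^sub>m n"
  shows "invertible_mat A"
  using assms by (auto simp: invertible_mat_def inverts_mat_def intro!: exI[of _ B])

lemma det_nonzero_obtain_inverse:
  fixes A :: "'a::field mat"
  assumes "A \<in> carrier_mat n n" "det A \<noteq> 0"
  obtains A' where "A' \<in> carrier_mat n n" "A * A' = 1\<^sub>m n"
  using det_non_zero_imp_unit[OF assms, of "()"] by (auto simp: Units_def ring_mat_def)

lemma mat_inv_eqI:
  fixes A :: "'a::field mat"
  assumes A: "A \<in> carrier_mat n n" and B: "B \<in> carrier_mat n n" and AB: "A * B = 1\<^sub>m n"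
  shows "mat_inv A = B"
proof -
  have BA: "B * A = 1\<^sub>m n" using mat_mult_left_right_inverse[OF A B AB] .
  then have "A \<in> Units (ring_mat TYPE('a) n ())" using A B AB by (auto simp: Units_def ring_mat_def)
  then obtain A' where A': "mat_inverse A = Some A'"
    using mat_inverse(1)[OF A, of "()"] by (cases "mat_inverse A") auto
  then have "A' * A = 1\<^sub>m n" "A' \<in> carrier_mat n n" using mat_inverse(2)[OF A] by auto
  then have "A' = A' * (A * B)" using AB by simp
  also have "\<dots> = B" using A B \<open>A' \<in> _\<close> \<open>A' * A = _\<close> by (simp add: assoc_mult_mat[symmetric])
  finally show ?thesis using A' by simp
qed

section \<open>Divisibility by \<open>b\<close> and the kernel of \<open>M[G,b]\<close>\<close>

text \<open>
  In characteristic zero a derivative lowers the multiplicity of a root by exactly one, which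
  peels off one linear factor and one derivative at a time.
\<close>

lemma linear_power_dvd_iff_derivatives_vanish:
  fixes f :: "'a::field_char_0 poly"
  shows "[:-\<beta>, 1:] ^ k dvd f \<longleftrightarrow> (\<forall>l<k. poly ((pderiv ^^ l) f) \<beta> = 0)"
proof (induction k arbitrary: f)
  case (Suc k)
  have "[:-\<beta>, 1:] ^ Suc k dvd f \<longleftrightarrow> poly f \<beta> = 0 \<and> [:-\<beta>, 1:] ^ k dvd pderiv f"
  proof (cases "poly f \<beta> = 0")
    case root: True
    show ?thesis
    proof (cases "pderiv f = 0")
      case True
      then obtain h where "f = [:h:]" using pderiv_iszero by blast
      then show ?thesis using root by simp
    next
      case False
      then have f: "f \<noteq> 0" by auto
      then have "Polynomial.order \<beta> f = Suc (Polynomial.order \<beta> (pderiv f))"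
        using root by (rule order_pderiv)
      then show ?thesis using root False f by (simp only: order_divides) simp
    qed
  next
    case False
    have "[:-\<beta>, 1:] dvd [:-\<beta>, 1:] ^ Suc k" by (rule dvd_power) simp
    then show ?thesis using False by (meson dvd_trans poly_eq_0_iff_dvd)
  qed
  also have "\<dots> \<longleftrightarrow> (\<forall>l<Suc k. poly ((pderiv ^^ l) f) \<beta> = 0)"
    unfolding Suc.IH All_less_Suc2 by (simp add: funpow_Suc_right del: funpow.simps(2))
  finally show ?case .
qed simp

lemma coprime_linear_factors:
  fixes a b :: "'a::field"
  assumes "a \<noteq> b"
  shows "coprime [:-a, 1:] [:-b, 1:]"
proof (rule coprimeI)
  fix c assume "c dvd [:-a, 1:]" "c dvd [:-b, 1:]"
  then have "c dvd [:-a, 1:] - [:-b, 1:]" by (rule dvd_diff)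
  then have "c dvd [:b - a:]" by simp
  moreover have "[:b - a:] dvd 1" using assms by (simp add: is_unit_const_poly_iff dvd_field_iff)
  ultimately show "is_unit c" by (rule dvd_trans)
qed

text \<open>
  The prime powers \<open>(\<lambda> - \<beta>\<^sub>j)\<^bsup>k\<^sub>j\<^esup>\<close> are pairwise coprime, so \<open>b\<close> divides \<open>f\<close> as soon as each of them does.
\<close>

lemma root_listing_dvd_iff:
  assumes "root_listing b bs"
  shows "b dvd f \<longleftrightarrow> (\<forall>(\<beta>,k)\<in>set bs. \<forall>l<k. poly ((pderiv ^^ l) f) \<beta> = 0)"
proof -
  have "distinct (map fst bs) \<Longrightarrow>
     (\<Prod>(\<beta>,k)\<leftarrow>bs. [:-\<beta>, 1:] ^ k) dvd f \<longleftrightarrow> (\<forall>(\<beta>,k)\<in>set bs. [:-\<beta>, 1:] ^ k dvd f)"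
  proof (induction bs)
    case (Cons y bs)
    obtain \<beta> k where y: "y = (\<beta>, k)" by force
    let ?g = "\<lambda>(\<beta>,k). [:-\<beta>, 1:] ^ k :: complex poly"
    have "coprime (?g y) (prod_list (map ?g bs))"
      using Cons.prems by (induction bs) (auto simp: y coprime_linear_factors)
    then have "?g y * prod_list (map ?g bs) dvd f \<longleftrightarrow> ?g y dvd f \<and> prod_list (map ?g bs) dvd f"
      by (meson divides_mult dvd_mult_left dvd_mult_right)
    then show ?case using Cons by (simp add: y)
  qed simp
  then show ?thesis
    using assms unfolding root_listing_def linear_power_dvd_iff_derivatives_vanish by fast
qed

lemma poly_higher_pderiv_sum_const:
  fixes g :: "'b \<Rightarrow> 'a::{comm_ring_1,semiring_no_zero_divisors} poly"
  shows "poly ((pderiv ^^ l) (\<Sum>j\<in>J. g j * [:c j:])) \<beta> = (\<Sum>j\<in>J. poly ((pderiv ^^ l) (g j)) \<beta> * c j)"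
proof -
  have "(pderiv ^^ l) (g j * [:c j:]) = (pderiv ^^ l) (g j) * [:c j:]" for j
    by (simp add: higher_pderiv_smult)
  then show ?thesis by (simp add: higher_pderiv_sum poly_sum mult.commute)
qed

text \<open>
  Evaluating the \<open>l\<close>-th derivative commutes with taking a combination of the columns of \<open>G\<close> with
  constant coefficients. Hence the rows of \<open>M[G,b]\<close> that come from row \<open>a\<close> of \<open>G\<close> say exactly that
  the polynomial in row \<open>a\<close> of \<open>G x\<close> vanishes at each root of \<open>b\<close> to the required order.
\<close>

lemma hom_solution_M_mat_iff_dvd:
  assumes G: "G \<in> carrier_mat m p" and b: "root_listing b bs"
  shows "hom_solution (M_mat G bs) x \<longleftrightarrow>
    x \<in> carrier_vec p \<and> (\<forall>a<m. b dvd (\<Sum>j<p. G $$ (a,j) * [:x $ j:]))"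
proof -
  let ?N = "\<lambda>\<beta> l. map_mat (\<lambda>f. poly ((pderiv ^^ l) f) \<beta>) G"
  define R where "R = concat (map (\<lambda>(\<beta>,k). concat (map (\<lambda>l. rows (?N \<beta> l)) [0..<k])) bs)"
  have M: "M_mat G bs = mat_of_rows p R" using G by (simp add: M_mat_def R_def)
  have R: "set R = {row (?N \<beta> l) a | \<beta> k l a. (\<beta>,k) \<in> set bs \<and> l < k \<and> a < m}"
    using G by (fastforce simp: R_def rows_def)
  then have Rc: "set R \<subseteq> carrier_vec p" using G by auto
  define F where "F a = (\<Sum>j<p. G $$ (a,j) * [:x $ j:])" for a
  have "mat_of_rows p R *\<^sub>v x = 0\<^sub>v (length R) \<longleftrightarrow> (\<forall>a<m. b dvd F a)"
    if x: "x \<in> carrier_vec p"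
  proof -
    have row: "row (?N \<beta> l) a \<bullet> x = poly ((pderiv ^^ l) (F a)) \<beta>" if "a < m" for \<beta> l a
      unfolding poly_higher_pderiv_sum_const F_def
      using that x G by (auto simp: scalar_prod_def atLeast0LessThan intro!: sum.cong)
    have "mat_of_rows p R *\<^sub>v x = 0\<^sub>v (length R) \<longleftrightarrow> (\<forall>i<length R. R ! i \<bullet> x = 0)"
      using Rc by (auto simp: vec_eq_iff subset_code(1))
    also have "\<dots> \<longleftrightarrow> (\<forall>v\<in>set R. v \<bullet> x = 0)" by (simp add: all_set_conv_all_nth)
    also have "\<dots> \<longleftrightarrow> (\<forall>a<m. \<forall>(\<beta>,k)\<in>set bs. \<forall>l<k. row (?N \<beta> l) a \<bullet> x = 0)"
      unfolding R by blast
    also have "\<dots> \<longleftrightarrow> (\<forall>a<m. b dvd F a)"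
      by (simp add: row root_listing_dvd_iff[OF b] cong: ball_cong)
    finally show ?thesis .
  qed
  then show ?thesis by (auto simp: hom_solution_def M F_def)
qed

section \<open>Kronecker products and row-wise vectorisation\<close>

lemma sum_lessThan_mult_as_double_sum:
  fixes f :: "nat \<Rightarrow> nat \<Rightarrow> 'a::comm_monoid_add"
  shows "(\<Sum>j<m * n. f (j div n) (j mod n)) = (\<Sum>k<m. \<Sum>l<n. f k l)"
proof -
  have "(\<Sum>j<m * n. f (j div n) (j mod n)) = (\<Sum>k<m. \<Sum>j=k*n..<k*n+n. f (j div n) (j mod n))"
    by (simp add: sum.nat_group)
  also have "\<dots> = (\<Sum>k<m. \<Sum>l<n. f k l)"
  proof (rule sum.cong[OF refl])
    fix k
    have "(\<Sum>j=k*n..<k*n+n. f (j div n) (j mod n)) = (\<Sum>l<n. f ((l + k*n) div n) ((l + k*n) mod n))"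
      using sum.shift_bounds_nat_ivl[of "\<lambda>j. f (j div n) (j mod n)" 0 "k*n" n]
      by (simp add: atLeast0LessThan add.commute)
    then show "(\<Sum>j=k*n..<k*n+n. f (j div n) (j mod n)) = (\<Sum>l<n. f k l)"
      by (auto intro: sum.cong)
  qed
  finally show ?thesis .
qed

text \<open>
  The identity \<open>(X \<otimes> Y\<^sup>T) vec(W) = vec(X W Y)\<close> for the row-by-row vectorisation \<open>vec\<close>, whose
  entry \<open>j\<close> is the matrix entry in row \<open>j div n\<close> and column \<open>j mod n\<close>.
\<close>

lemma kronecker_transpose_row_product:
  fixes X Y W :: "'a::comm_semiring_1 mat"
  assumes X: "X \<in> carrier_mat n n" and Y: "Y \<in> carrier_mat n n" and W: "W \<in> carrier_mat n n"
    and a: "a < n * n"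
  shows "(\<Sum>j<n * n. kronecker X (transpose_mat Y) $$ (a,j) * W $$ (j div n, j mod n)) =
    (X * W * Y) $$ (a div n, a mod n)"
proof -
  have n: "0 < n" using a by (cases n) auto
  have dm: "j div n < n" "j mod n < n" if "j < n * n" for j
    using that n by (auto simp: less_mult_imp_div_less)
  have "(\<Sum>j<n * n. kronecker X (transpose_mat Y) $$ (a,j) * W $$ (j div n, j mod n)) =
    (\<Sum>j<n * n. X $$ (a div n, j div n) * Y $$ (j mod n, a mod n) * W $$ (j div n, j mod n))"
    using X Y a by (intro sum.cong) (auto simp: kronecker_def dm)
  also have "\<dots> = (\<Sum>k<n. \<Sum>l<n. X $$ (a div n, k) * Y $$ (l, a mod n) * W $$ (k, l))"
    by (rule sum_lessThan_mult_as_double_sum)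
  also have "\<dots> = (\<Sum>l<n. (\<Sum>k<n. X $$ (a div n, k) * W $$ (k, l)) * Y $$ (l, a mod n))"
    by (subst sum.swap) (simp add: sum_distrib_right sum_distrib_left mult_ac)
  also have "\<dots> = (X * W * Y) $$ (a div n, a mod n)"
    using X Y W dm[OF a]
    by (auto simp: scalar_prod_def atLeast0LessThan simp del: assoc_mult_mat intro!: sum.cong)
  finally show ?thesis .
qed

section \<open>The adjugate and the Smith normal form\<close>

lemma diag_chain_dvd:
  fixes s :: "nat \<Rightarrow> 'a::comm_monoid_mult"
  assumes "\<And>i. Suc i < n \<Longrightarrow> s i dvd s (Suc i)" and "i \<le> j" "j < n"
  shows "s i dvd s j"
  using \<open>i \<le> j\<close> \<open>j < n\<close> by (induction rule: dec_induct) (auto intro: dvd_trans assms(1))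

text \<open>
  Write \<open>F = P S Q\<close> and \<open>d = s\<^sub>1 \<dots> s\<^sub>n\<^sub>-\<^sub>1\<close>. As every \<open>s\<^sub>i\<close> divides \<open>s\<^sub>n\<close>, the matrix
  \<open>C = Q\<inverse> diag(s\<^sub>n / s\<^sub>i) P\<inverse>\<close> is polynomial, and it satisfies \<open>F C = C F = s\<^sub>n I\<close>. The adjugate
  satisfies the same equation with \<open>det F = u d s\<^sub>n\<close> in place of \<open>s\<^sub>n\<close>, where \<open>u = det P det Q\<close> is a
  unit, so cancelling \<open>s\<^sub>n\<close> leaves \<open>F\<^sup>* = u d C\<close>. The matrix \<open>u C\<close> is the \<open>C\<close> of the statement: it is
  \<open>F\<^sup>*\<close> divided by \<open>d\<close>, and the division is exact.
\<close>

lemma smith_adjugate_factorisation: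
  assumes n: "n \<ge> 1" and F: "F \<in> carrier_mat n n" and smith: "smith_normal_form n F S"
  obtains C u where "C \<in> carrier_mat n n" "u dvd 1"
    "adj_mat F = (\<Prod>i<n-1. S $$ (i,i)) \<cdot>\<^sub>m C"
    "F * C = (u * S $$ (n-1,n-1)) \<cdot>\<^sub>m 1\<^sub>m n" "C * F = (u * S $$ (n-1,n-1)) \<cdot>\<^sub>m 1\<^sub>m n"
proof -
  define s where "s i = S $$ (i,i)" for i
  define d where "d = (\<Prod>i<n-1. s i)"
  have S: "S \<in> carrier_mat n n" "diagonal_mat S" and eq: "equivalent_mats n F S"
    and monic: "\<And>i. i < n \<Longrightarrow> lead_coeff (s i) = 1"
    and chain: "\<And>i. Suc i < n \<Longrightarrow> s i dvd s (Suc i)"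
    using smith by (auto simp: smith_normal_form_def s_def)
  obtain P Q where PQ: "P \<in> GL n" "Q \<in> GL n" and FPQ: "F = P * S * Q"
    using eq by (auto simp: equivalent_mats_def)
  have P: "P \<in> carrier_mat n n" and Q: "Q \<in> carrier_mat n n" using PQ by (auto simp: GL_def)
  obtain P' where P': "P' \<in> carrier_mat n n" "P * P' = 1\<^sub>m n" "P' * P = 1\<^sub>m n"
    using GL_obtain_inverse[OF PQ(1)] .
  obtain Q' where Q': "Q' \<in> carrier_mat n n" "Q * Q' = 1\<^sub>m n" "Q' * Q = 1\<^sub>m n"
    using GL_obtain_inverse[OF PQ(2)] .
  define E where "E = mat n n (\<lambda>(i,j). if i = j then s (n-1) div s i else 0)"
  have E: "E \<in> carrier_mat n n" by (simp add: E_def)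
  have dvd: "s i dvd s (n-1)" if "i < n" for i
    using diag_chain_dvd[of n s i "n-1"] chain that n by auto
  have S_entry: "S $$ (i,j) = (if i = j then s i else 0)" if "i < n" "j < n" for i j
    using S that by (auto simp: diagonal_mat_def s_def)
  have SE: "S * E = s (n-1) \<cdot>\<^sub>m 1\<^sub>m n" and ES: "E * S = s (n-1) \<cdot>\<^sub>m 1\<^sub>m n"
    using S dvd by (auto simp: E_def scalar_prod_def S_entry if_distrib[of "\<lambda>x. x * _"]
        if_distrib[of "\<lambda>x. _ * x"] cong: if_cong intro!: eq_matI)
  define C where "C = Q' * E * P'"
  have C: "C \<in> carrier_mat n n" using P' Q' E by (simp add: C_def)
  have "F * C = P * (S * ((Q * Q') * E)) * P'"
    using P Q P'(1) Q'(1) S(1) E by (simp add: FPQ C_def assoc_mult_mat[of _ n n _ n _ n])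
  also have "\<dots> = s (n-1) \<cdot>\<^sub>m 1\<^sub>m n"
    using P P' E by (simp add: Q'(2) SE mult_smult_distrib[of _ n n _ n] mult_smult_assoc_mat[of _ n n _ n])
  finally have FC: "F * C = s (n-1) \<cdot>\<^sub>m 1\<^sub>m n" .
  have "C * F = Q' * (E * ((P' * P) * S)) * Q"
    using P Q P'(1) Q'(1) S(1) E by (simp add: FPQ C_def assoc_mult_mat[of _ n n _ n _ n])
  also have "\<dots> = s (n-1) \<cdot>\<^sub>m 1\<^sub>m n"
    using Q Q' S by (simp add: P'(3) ES mult_smult_distrib[of _ n n _ n] mult_smult_assoc_mat[of _ n n _ n])
  finally have CF: "C * F = s (n-1) \<cdot>\<^sub>m 1\<^sub>m n" .
  define u where "u = det P * det Q"
  have "det P * det P' = 1" "det Q * det Q' = 1"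
    using det_mult[OF P P'(1)] det_mult[OF Q Q'(1)] P' Q' by auto
  then have u: "u dvd 1" unfolding u_def by (metis dvd_triv_left mult_dvd_mono mult_1)
  have "det S = prod_list (diag_mat S)"
    using S by (intro det_upper_triangular) (auto simp: diagonal_mat_def upper_triangular_def)
  also have "\<dots> = (\<Prod>i<n. s i)"
    using S(1) by (simp add: diag_mat_def s_def[symmetric] prod.distinct_set_conv_list[symmetric]
        atLeast0LessThan)
  also have "\<dots> = d * s (n-1)"
    using n prod.lessThan_Suc[of s "n-1"] by (simp add: d_def)
  finally have detF: "det F = u * d * s (n-1)"
    using P Q S by (simp add: FPQ u_def det_mult[of _ n] mult_ac)
  have adj: "adj_mat F \<in> carrier_mat n n" "adj_mat F * F = det F \<cdot>\<^sub>m 1\<^sub>m n"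
    using adj_mat[OF F] by auto
  have "s (n-1) \<cdot>\<^sub>m adj_mat F = adj_mat F * (F * C)"
    using adj by (simp add: FC mult_smult_distrib[of _ n n _ n])
  also have "\<dots> = adj_mat F * F * C" by (rule assoc_mult_mat[symmetric, OF adj(1) F C])
  also have "\<dots> = det F \<cdot>\<^sub>m C" using C by (simp add: adj mult_smult_assoc_mat[of _ n n _ n])
  finally have key: "s (n-1) \<cdot>\<^sub>m adj_mat F = (u * d * s (n-1)) \<cdot>\<^sub>m C" by (simp add: detF)
  have "s (n-1) \<noteq> 0" using monic[of "n-1"] n by auto
  have "adj_mat F = d \<cdot>\<^sub>m (u \<cdot>\<^sub>m C)"
  proof (rule eq_matI)
    fix i j assume "i < dim_row (d \<cdot>\<^sub>m (u \<cdot>\<^sub>m C))" "j < dim_col (d \<cdot>\<^sub>m (u \<cdot>\<^sub>m C))"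
    then have "s (n-1) * adj_mat F $$ (i,j) = s (n-1) * (d * (u * C $$ (i,j)))"
      using arg_cong[OF key, of "\<lambda>X. X $$ (i,j)"] adj C by (simp add: mult_ac)
    then show "adj_mat F $$ (i,j) = (d \<cdot>\<^sub>m (u \<cdot>\<^sub>m C)) $$ (i,j)"
      using \<open>s (n-1) \<noteq> 0\<close> \<open>i < _\<close> \<open>j < _\<close> by simp
  qed (use adj C in auto)
  moreover have "F * (u \<cdot>\<^sub>m C) = (u * s (n-1)) \<cdot>\<^sub>m 1\<^sub>m n" "(u \<cdot>\<^sub>m C) * F = (u * s (n-1)) \<cdot>\<^sub>m 1\<^sub>m n"
    using F C by (auto simp: FC CF mult_smult_distrib[of _ n n _ n] mult_smult_assoc_mat[of _ n n _ n]
        intro!: eq_matI)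
  ultimately show thesis
    using that[of "u \<cdot>\<^sub>m C" u] C u by (simp add: d_def s_def)
qed

text \<open>
  Over the fraction field \<open>C = u s F\<inverse>\<close>, so \<open>s\<close> divides \<open>C X\<close> entrywise iff \<open>F\<inverse> X\<close> has its
  entries in the ring itself, that is, iff \<open>F\<close> divides \<open>X\<close> from the left.
\<close>

lemma entries_dvd_iff_left_factor:
  fixes F C X :: "'a::idom_divide mat"
  assumes F: "F \<in> carrier_mat n n" and C: "C \<in> carrier_mat n n" and X: "X \<in> carrier_mat n n"
    and u: "u dvd 1" and s: "s \<noteq> 0"
    and FC: "F * C = (u * s) \<cdot>\<^sub>m 1\<^sub>m n" and CF: "C * F = (u * s) \<cdot>\<^sub>m 1\<^sub>m n"
  shows "(\<forall>i<n. \<forall>j<n. s dvd (C * X) $$ (i,j)) \<longleftrightarrow> (\<exists>W\<in>carrier_mat n n. X = F * W)"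
proof
  assume dvd: "\<forall>i<n. \<forall>j<n. s dvd (C * X) $$ (i,j)"
  obtain v where v: "u * v = 1" using u by (metis dvdE)
  define W where "W = mat n n (\<lambda>(i,j). (C * X) $$ (i,j) div s)"
  have W: "W \<in> carrier_mat n n" by (simp add: W_def)
  have CX: "C * X = s \<cdot>\<^sub>m W" using dvd C X by (auto simp: W_def intro!: eq_matI)
  have "(u * s) \<cdot>\<^sub>m X = F * C * X"
    using X by (simp add: FC mult_smult_assoc_mat[of _ n n _ n])
  also have "\<dots> = s \<cdot>\<^sub>m (F * W)" using F C X W by (simp add: CX mult_smult_distrib[of _ n n _ n])
  finally have eq: "(u * s) \<cdot>\<^sub>m X = s \<cdot>\<^sub>m (F * W)" .
  have "X = F * (v \<cdot>\<^sub>m W)"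
  proof (rule eq_matI)
    fix i j assume "i < dim_row (F * (v \<cdot>\<^sub>m W))" "j < dim_col (F * (v \<cdot>\<^sub>m W))"
    then have ij: "i < n" "j < n" using F W by auto
    then have "u * X $$ (i,j) = (F * W) $$ (i,j)"
      using arg_cong[OF eq, of "\<lambda>Y. Y $$ (i,j)"] F W X s by (simp add: mult_ac del: index_mult_mat(1))
    then have "v * (F * W) $$ (i,j) = (u * v) * X $$ (i,j)" by (metis mult.assoc mult.commute)
    then show "X $$ (i,j) = (F * (v \<cdot>\<^sub>m W)) $$ (i,j)"
      using F W ij v by (simp add: mult_smult_distrib[of _ n n _ n] del: index_mult_mat(1))
  qed (use F X W in auto)
  then show "\<exists>W\<in>carrier_mat n n. X = F * W" using W by auto
next
  assume "\<exists>W\<in>carrier_mat n n. X = F * W"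
  then obtain W where W: "W \<in> carrier_mat n n" "X = F * W" by blast
  then have "C * X = (u * s) \<cdot>\<^sub>m W"
    using F C by (simp add: assoc_mult_mat[symmetric] CF mult_smult_assoc_mat[of _ n n _ n])
  then show "\<forall>i<n. \<forall>j<n. s dvd (C * X) $$ (i,j)" using W by simp
qed

section \<open>Left division by a monic matrix polynomial\<close>

abbreviation const_mat :: "'a::zero mat \<Rightarrow> 'a poly mat" where
  "const_mat \<equiv> map_mat (\<lambda>c. [:c:])"

abbreviation coeff_mat :: "nat \<Rightarrow> 'a::zero poly mat \<Rightarrow> 'a mat" where
  "coeff_mat m \<equiv> map_mat (\<lambda>p. poly.coeff p m)"

lemma poly_mat_eqI:
  assumes "F \<in> carrier_mat n k" "G \<in> carrier_mat n k" "\<And>m. coeff_mat m F = coeff_mat m G"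
  shows "F = G"
proof (rule eq_matI)
  fix i j assume "i < dim_row G" "j < dim_col G"
  then show "F $$ (i,j) = G $$ (i,j)"
    using assms(1,2) arg_cong[OF assms(3), of "\<lambda>X. X $$ (i,j)"] by (auto intro!: poly_eqI)
qed (use assms in auto)

lemma coeff_mat_const_mult:
  fixes V :: "'a::comm_semiring_1 mat"
  assumes "V \<in> carrier_mat n n" "F \<in> carrier_mat n n"
  shows "coeff_mat m (const_mat V * F) = V * coeff_mat m F"
    and "coeff_mat m (F * const_mat V) = coeff_mat m F * V"
  using assms by (auto simp: scalar_prod_def coeff_sum mult.commute intro!: eq_matI sum.cong)

lemma monic_matpoly_carrier [simp]: "monic_matpoly n r A \<in> carrier_mat n n"
  by (simp add: monic_matpoly_def)

lemma coeff_mat_monic_matpoly: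
  assumes A: "\<forall>i\<in>{1..r}. A i \<in> carrier_mat n n"
  shows "coeff_mat m (monic_matpoly n r A) =
    (if m = r then 1\<^sub>m n else if m < r then A (r - m) else 0\<^sub>m n n)"
proof -
  have "A (r - m) \<in> carrier_mat n n" if "m < r" using A that by simp
  then have carrier: "(if m = r then 1\<^sub>m n else if m < r then A (r - m) else 0\<^sub>m n n) \<in> carrier_mat n n"
    by simp
  have sum: "(\<Sum>k=Suc 0..r. if r - k = m then A k $$ (i,j) else 0) =
    (if m < r then A (r - m) $$ (i,j) else 0)" for i j
  proof (cases "m < r")
    case True
    have "(\<Sum>k=Suc 0..r. if r - k = m then A k $$ (i,j) else 0) =
        (\<Sum>k=Suc 0..r. if k = r - m then A (r - m) $$ (i,j) else 0)"
      using True by (intro sum.cong) auto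
    then show ?thesis using True by simp
  next
    case False
    then have "(\<Sum>k=Suc 0..r. if r - k = m then A k $$ (i,j) else 0) = 0"
      by (intro sum.neutral) auto
    then show ?thesis using False by simp
  qed
  show ?thesis
  proof (rule eq_matI)
    fix i j
    assume "i < dim_row (if m = r then 1\<^sub>m n else if m < r then A (r - m) else 0\<^sub>m n n)"
      "j < dim_col (if m = r then 1\<^sub>m n else if m < r then A (r - m) else 0\<^sub>m n n)"
    then have "i < n" "j < n" using carrier by auto
    then show "coeff_mat m (monic_matpoly n r A) $$ (i,j) =
      (if m = r then 1\<^sub>m n else if m < r then A (r - m) else 0\<^sub>m n n) $$ (i,j)"
      by (auto simp: monic_matpoly_def coeff_sum sum)
  qed (use carrier in \<open>auto simp: monic_matpoly_def\<close>)
qed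

lemma coeff_mult_top:
  fixes p q :: "'a::comm_semiring_1 poly"
  assumes "\<And>m. m > r \<Longrightarrow> poly.coeff p m = 0" "\<And>m. m > t \<Longrightarrow> poly.coeff q m = 0"
  shows "poly.coeff (p * q) (r + t) = poly.coeff p r * poly.coeff q t"
proof -
  have "poly.coeff (p * q) (r + t) = (\<Sum>i\<le>r+t. poly.coeff p i * poly.coeff q (r + t - i))"
    by (rule coeff_mult)
  also have "\<dots> = (\<Sum>i\<le>r+t. if i = r then poly.coeff p r * poly.coeff q t else 0)"
  proof (rule sum.cong[OF refl])
    fix i
    show "poly.coeff p i * poly.coeff q (r + t - i) =
        (if i = r then poly.coeff p r * poly.coeff q t else 0)"
      using assms by (cases i r rule: linorder_cases) auto
  qed
  finally show ?thesis by simp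
qed

text \<open>
  The leading coefficient matrix of \<open>F\<close> is the identity, so no cancellation can occur at the top:
  the coefficient of \<open>F U\<close> at \<open>r + t\<close> is that of \<open>U\<close> at \<open>t\<close>, for \<open>t\<close> the degree of \<open>U\<close>.
\<close>

lemma monic_mult_low_degree_imp_zero:
  fixes F U :: "'a::comm_ring_1 poly mat"
  assumes F: "F \<in> carrier_mat n n" and U: "U \<in> carrier_mat n n"
    and monic: "coeff_mat r F = 1\<^sub>m n" "\<And>m. m > r \<Longrightarrow> coeff_mat m F = 0\<^sub>m n n"
    and low: "\<And>m. m \<ge> r \<Longrightarrow> coeff_mat m (F * U) = 0\<^sub>m n n"
  shows "U = 0\<^sub>m n n"
proof -
  \<comment> \<open>Induction on a strict bound \<open>t\<close> for the degree of \<open>U\<close>, lowered by one in each step.\<close>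
  have descend: "U = 0\<^sub>m n n" if "\<And>m. m \<ge> t \<Longrightarrow> coeff_mat m U = 0\<^sub>m n n" for t
    using that
  proof (induction t)
    case 0
    then show ?case using U by (intro poly_mat_eqI[of _ n n]) auto
  next
    case (Suc t)
    have F_high: "poly.coeff (F $$ (i,k)) m = 0" if "m > r" "i < n" "k < n" for i k m
      using arg_cong[OF monic(2)[OF that(1)], of "\<lambda>X. X $$ (i,k)"] F that by simp
    have U_high: "poly.coeff (U $$ (k,j)) m = 0" if "m > t" "k < n" "j < n" for k j m
      using arg_cong[OF Suc.prems[of m], of "\<lambda>X. X $$ (k,j)"] U that by simp
    have "coeff_mat t U = 1\<^sub>m n * coeff_mat t U" using U by simp
    also have "\<dots> = coeff_mat (r + t) (F * U)"
      unfolding monic(1)[symmetric] using F U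
      by (auto simp: scalar_prod_def coeff_sum coeff_mult_top F_high U_high intro!: eq_matI sum.cong)
    also have "\<dots> = 0\<^sub>m n n" by (rule low) simp
    finally have "coeff_mat t U = 0\<^sub>m n n" .
    then have "coeff_mat m U = 0\<^sub>m n n" if "m \<ge> t" for m
      using Suc.prems that by (cases "m = t") auto
    then show ?case by (rule Suc.IH)
  qed
  define t where "t = Suc (\<Sum>i<n. \<Sum>j<n. degree (U $$ (i,j)))"
  have "degree (U $$ (i,j)) < t" if "i < n" "j < n" for i j
  proof -
    have "degree (U $$ (i,j)) \<le> (\<Sum>j<n. degree (U $$ (i,j)))"
      using that by (intro member_le_sum) auto
    also have "\<dots> \<le> (\<Sum>i<n. \<Sum>j<n. degree (U $$ (i,j)))"
      using that by (intro member_le_sum) auto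
    finally show ?thesis by (simp add: t_def)
  qed
  then have "coeff_mat m U = 0\<^sub>m n n" if "m \<ge> t" for m
    using U that by (intro eq_matI) (auto intro!: coeff_eq_0 intro: less_le_trans)
  then show ?thesis by (rule descend)
qed

lemma const_intertwines_iff:
  assumes A: "\<forall>i\<in>{1..r}. A i \<in> carrier_mat n n"
    and B: "\<forall>i\<in>{1..r}. B i \<in> carrier_mat n n"
    and V: "V \<in> carrier_mat n n"
  shows "const_mat V * monic_matpoly n r A = monic_matpoly n r B * const_mat V \<longleftrightarrow>
    (\<forall>i\<in>{1..r}. V * A i = B i * V)" (is "?L = ?R \<longleftrightarrow> _")
proof -
  have coeffs: "coeff_mat m ?L = (if m = r then V else if m < r then V * A (r - m) else 0\<^sub>m n n)"
    "coeff_mat m ?R = (if m = r then V else if m < r then B (r - m) * V else 0\<^sub>m n n)" for m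
    using V by (simp_all add: coeff_mat_const_mult coeff_mat_monic_matpoly[OF A]
        coeff_mat_monic_matpoly[OF B])
  show ?thesis
  proof
    assume eq: "?L = ?R"
    show "\<forall>i\<in>{1..r}. V * A i = B i * V"
    proof
      fix i assume i: "i \<in> {1..r}"
      then have "r - i < r" "r - (r - i) = i" by auto
      then show "V * A i = B i * V" using coeffs[of "r - i"] eq by simp
    qed
  next
    assume "\<forall>i\<in>{1..r}. V * A i = B i * V"
    then have "coeff_mat m ?L = coeff_mat m ?R" for m by (simp add: coeffs)
    moreover have "?L \<in> carrier_mat n n" "?R \<in> carrier_mat n n"
      using V by (auto intro: mult_carrier_mat[of _ n n])
    ultimately show "?L = ?R" by (intro poly_mat_eqI)
  qed
qed

text \<open>
  Both \<open>V A(\<lambda>)\<close> and \<open>B(\<lambda>) V\<close> have the coefficient \<open>V\<close> at \<open>\<lambda>\<^sup>r\<close> and none above it. If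
  \<open>V A(\<lambda>) = B(\<lambda>) W(\<lambda>)\<close>, then \<open>B(\<lambda>) (W(\<lambda>) - V)\<close> therefore has degree below \<open>r\<close>. As \<open>B(\<lambda>)\<close> is
  monic, this forces \<open>W(\<lambda>) = V\<close>, and the coefficients can be compared.
\<close>

lemma left_divides_iff_intertwines:
  assumes A: "\<forall>i\<in>{1..r}. A i \<in> carrier_mat n n"
    and B: "\<forall>i\<in>{1..r}. B i \<in> carrier_mat n n"
    and V: "V \<in> carrier_mat n n"
  shows "(\<exists>W\<in>carrier_mat n n. const_mat V * monic_matpoly n r A = monic_matpoly n r B * W) \<longleftrightarrow>
    (\<forall>i\<in>{1..r}. V * A i = B i * V)"
proof -
  let ?FA = "monic_matpoly n r A" and ?FB = "monic_matpoly n r B"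
  have cV: "const_mat V \<in> carrier_mat n n" using V by simp
  have "W = const_mat V" if W: "W \<in> carrier_mat n n" and eq: "const_mat V * ?FA = ?FB * W" for W
  proof -
    have U: "W - const_mat V \<in> carrier_mat n n" by (rule minus_carrier_mat[OF cV])
    have "?FB * (W - const_mat V) = const_mat V * ?FA - ?FB * const_mat V"
      using W cV by (simp add: eq mult_minus_distrib_mat[of _ n n _ n])
    then have "coeff_mat m (?FB * (W - const_mat V)) =
        coeff_mat m (const_mat V * ?FA) - coeff_mat m (?FB * const_mat V)" for m
      using cV V by (auto simp: carrier_matD[OF monic_matpoly_carrier] simp del: index_mult_mat(1))
    then have "coeff_mat m (?FB * (W - const_mat V)) = 0\<^sub>m n n" if "m \<ge> r" for m
      using V that by (simp add: coeff_mat_const_mult coeff_mat_monic_matpoly[OF A]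
          coeff_mat_monic_matpoly[OF B])
    then have zero: "W - const_mat V = 0\<^sub>m n n"
      by (intro monic_mult_low_degree_imp_zero[OF monic_matpoly_carrier[of n r B] U, of r])
        (simp_all add: coeff_mat_monic_matpoly[OF B])
    show ?thesis
    proof (rule eq_matI)
      fix i j assume "i < dim_row (const_mat V)" "j < dim_col (const_mat V)"
      then show "W $$ (i,j) = const_mat V $$ (i,j)"
        using arg_cong[OF zero, of "\<lambda>X. X $$ (i,j)"] W V by simp
    qed (use W V in auto)
  qed
  then show ?thesis using const_intertwines_iff[OF A B V] cV by metis
qed

section \<open>Solutions of the linear system and similarity\<close>

text \<open>
  The three translations combined: kernel vectors of \<open>M[D,s\<^sub>n]\<close> are the vectorised matrices \<open>V\<close> for
  which \<open>s\<^sub>n\<close> divides \<open>C V A(\<lambda>)\<close>, where \<open>C\<close> is the reduced adjugate of \<open>B(\<lambda>)\<close>; these are the \<open>V\<close> for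
  which \<open>B(\<lambda>)\<close> divides \<open>V A(\<lambda>)\<close> from the left, and thus the matrices that intertwine the families.
\<close>

lemma hom_solution_D_mat_iff_intertwines:
  assumes n: "n \<ge> 1"
    and A: "\<forall>i\<in>{1..r}. A i \<in> carrier_mat n n"
    and B: "\<forall>i\<in>{1..r}. B i \<in> carrier_mat n n"
    and smith: "smith_normal_form n (monic_matpoly n r B) S"
    and bs: "root_listing (S $$ (n-1, n-1)) bs"
  shows "hom_solution (M_mat (D_mat n S (monic_matpoly n r A) (monic_matpoly n r B)) bs) x \<longleftrightarrow>
    x \<in> carrier_vec (n * n) \<and> (\<forall>i\<in>{1..r}. V_mat n x * A i = B i * V_mat n x)"
proof -
  let ?FA = "monic_matpoly n r A" and ?FB = "monic_matpoly n r B"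
  let ?d = "\<Prod>i<n-1. S $$ (i,i)" and ?s = "S $$ (n-1,n-1)"
  obtain C u where C: "C \<in> carrier_mat n n" and u: "u dvd 1" and adj: "adj_mat ?FB = ?d \<cdot>\<^sub>m C"
    and FC: "?FB * C = (u * ?s) \<cdot>\<^sub>m 1\<^sub>m n" and CF: "C * ?FB = (u * ?s) \<cdot>\<^sub>m 1\<^sub>m n"
    using smith_adjugate_factorisation[OF n monic_matpoly_carrier smith] .
  have nz: "S $$ (i,i) \<noteq> 0" if "i < n" for i
    using smith that by (auto simp: smith_normal_form_def dest!: spec[of _ i])
  then have "?d \<noteq> 0" by auto
  then have "map_mat (\<lambda>f. f div ?d) (adj_mat ?FB) = C"
    unfolding adj using C by (auto intro!: eq_matI)
  then have D: "D_mat n S ?FA ?FB = kronecker C (transpose_mat ?FA)"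
    by (simp add: D_mat_def)
  have D_carrier: "D_mat n S ?FA ?FB \<in> carrier_mat (n * n) (n * n)"
    by (simp add: D kronecker_def carrier_matD[OF C] carrier_matD[OF monic_matpoly_carrier])
  let ?V = "V_mat n x"
  have V: "?V \<in> carrier_mat n n" by (simp add: V_mat_def)
  have cV: "const_mat ?V \<in> carrier_mat n n" using V by simp
  have row: "(\<Sum>j<n * n. D_mat n S ?FA ?FB $$ (a,j) * [:x $ j:]) =
      (C * (const_mat ?V * ?FA)) $$ (a div n, a mod n)" if a: "a < n * n" for a
  proof -
    have "(\<Sum>j<n * n. D_mat n S ?FA ?FB $$ (a,j) * [:x $ j:]) =
        (\<Sum>j<n * n. D_mat n S ?FA ?FB $$ (a,j) * const_mat ?V $$ (j div n, j mod n))"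
      using n by (intro sum.cong refl arg_cong2[of _ _ _ _ "(*)"])
        (auto simp: V_mat_def less_mult_imp_div_less)
    also have "\<dots> = (C * const_mat ?V * ?FA) $$ (a div n, a mod n)"
      unfolding D by (rule kronecker_transpose_row_product[OF C monic_matpoly_carrier cV a])
    finally show ?thesis by (simp only: assoc_mult_mat[OF C cV monic_matpoly_carrier])
  qed
  have "hom_solution (M_mat (D_mat n S ?FA ?FB) bs) x \<longleftrightarrow> x \<in> carrier_vec (n * n) \<and>
      (\<forall>a<n * n. ?s dvd (C * (const_mat ?V * ?FA)) $$ (a div n, a mod n))"
    unfolding hom_solution_M_mat_iff_dvd[OF D_carrier bs] using row by simp
  also have "(\<forall>a<n * n. ?s dvd (C * (const_mat ?V * ?FA)) $$ (a div n, a mod n)) \<longleftrightarrow>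
      (\<forall>i<n. \<forall>j<n. ?s dvd (C * (const_mat ?V * ?FA)) $$ (i, j))" (is "?l \<longleftrightarrow> ?r")
  proof
    assume l: ?l
    show ?r
    proof (intro allI impI)
      fix i j assume ij: "i < n" "j < n"
      then have "i * n + j < (i + 1) * n" by simp
      also have "\<dots> \<le> n * n" using ij by (intro mult_le_mono) auto
      finally show "?s dvd (C * (const_mat ?V * ?FA)) $$ (i, j)"
        using l[rule_format, of "i * n + j"] ij by simp
    qed
  next
    assume ?r
    then show ?l using n by (auto simp: less_mult_imp_div_less simp del: index_mult_mat(1))
  qed
  also have "\<dots> \<longleftrightarrow> (\<exists>W\<in>carrier_mat n n. const_mat ?V * ?FA = ?FB * W)"
    using cV nz n by (intro entries_dvd_iff_left_factor[OF _ C _ u _ FC CF]) (auto intro: mult_carrier_mat)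
  also have "\<dots> \<longleftrightarrow> (\<forall>i\<in>{1..r}. ?V * A i = B i * ?V)"
    by (rule left_divides_iff_intertwines[OF A B V])
  finally show ?thesis .
qed

lemma conjugate_by_inverse_if_intertwines:
  fixes V X Y :: "'a::field mat"
  assumes V: "V \<in> carrier_mat n n" "V' \<in> carrier_mat n n" "V * V' = 1\<^sub>m n"
    and X: "X \<in> carrier_mat n n" and Y: "Y \<in> carrier_mat n n" and eq: "V * X = Y * V"
  shows "X = mat_inv V * Y * V"
proof -
  have "V' * V = 1\<^sub>m n" by (rule mat_mult_left_right_inverse[OF V])
  then have "X = V' * V * X" using X by simp
  also have "\<dots> = V' * (Y * V)" using V X eq by (simp add: assoc_mult_mat[of _ n n _ n _ n])
  also have "\<dots> = V' * Y * V" using V Y by (simp add: assoc_mult_mat[of _ n n _ n _ n])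
  finally show ?thesis by (simp add: mat_inv_eqI[OF V])
qed

theorem corollary3:
  fixes n r :: nat
    and A B :: "nat \<Rightarrow> complex mat"
    and S :: "complex poly mat"
    and bs :: "(complex \<times> nat) list"
  assumes "n \<ge> 1"
    and "\<And>i. i \<in> {1..r} \<Longrightarrow> A i \<in> carrier_mat n n"
    and "\<And>i. i \<in> {1..r} \<Longrightarrow> B i \<in> carrier_mat n n"
    and "equivalent_mats n (monic_matpoly n r A) (monic_matpoly n r B)"
    and "smith_normal_form n (monic_matpoly n r A) S"
    and "smith_normal_form n (monic_matpoly n r B) S"
    and "root_listing (S $$ (n-1, n-1)) bs"
  defines "M \<equiv> M_mat (D_mat n S (monic_matpoly n r A) (monic_matpoly n r B)) bs"
  shows "(similar_families n r A B \<longleftrightarrow>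
            mat_rank M < n^2 \<and> (\<exists>x. hom_solution M x \<and> invertible_mat (V_mat n x))) \<and>
         (\<forall>x. hom_solution M x \<and> det (V_mat n x) \<noteq> 0 \<longrightarrow>
            (\<forall>i\<in>{1..r}. A i = mat_inv (V_mat n x) * B i * V_mat n x))"
proof -
  have sol: "hom_solution M x \<longleftrightarrow>
      x \<in> carrier_vec (n * n) \<and> (\<forall>i\<in>{1..r}. V_mat n x * A i = B i * V_mat n x)" for x
    unfolding M_def using assms by (intro hom_solution_D_mat_iff_intertwines) auto
  have dim_M: "dim_col M = n * n"
    by (simp add: M_def M_mat_def D_mat_def kronecker_def adj_mat_def monic_matpoly_def)
  have V: "V_mat n x \<in> carrier_mat n n" for x by (simp add: V_mat_def)
  have conj: "A i = mat_inv (V_mat n x) * B i * V_mat n x"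
    if "hom_solution M x" "V_mat n x * V' = 1\<^sub>m n" "V' \<in> carrier_mat n n" "i \<in> {1..r}" for x V' i
  proof -
    have "V_mat n x * A i = B i * V_mat n x" using that(1,4) sol by blast
    then show ?thesis
      by (rule conjugate_by_inverse_if_intertwines[OF V that(3,2) assms(2)[OF that(4)] assms(3)[OF that(4)]])
  qed
  have recover: "A i = mat_inv (V_mat n x) * B i * V_mat n x"
    if x: "hom_solution M x" "det (V_mat n x) \<noteq> 0" and i: "i \<in> {1..r}" for x i
  proof -
    obtain V' where "V' \<in> carrier_mat n n" "V_mat n x * V' = 1\<^sub>m n"
      using det_nonzero_obtain_inverse[OF V x(2)] .
    then show ?thesis using conj[OF x(1) _ _ i] by blast
  qed
  have similar: "similar_families n r A B"
    if x: "hom_solution M x" and inv: "invertible_mat (V_mat n x)" for x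
  proof -
    have "V_mat n x \<in> GL n" using V inv by (simp add: GL_def)
    then obtain V' where V': "V' \<in> carrier_mat n n" "V_mat n x * V' = 1\<^sub>m n" "V' * V_mat n x = 1\<^sub>m n"
      by (rule GL_obtain_inverse)
    have "mat_inv (V_mat n x) = V'" by (rule mat_inv_eqI[OF V V'(1,2)])
    moreover have "mat_inv V' = V_mat n x" by (rule mat_inv_eqI[OF V'(1) V V'(3)])
    ultimately have "\<forall>i\<in>{1..r}. A i = V' * B i * mat_inv V'" using conj[OF x V'(2,1)] by simp
    moreover have "V' \<in> GL n" using invertible_matI[OF V'(1) V V'(3,2)] V'(1) by (simp add: GL_def)
    ultimately show ?thesis unfolding similar_families_def by blast
  qed
  have solvable: "mat_rank M < n\<^sup>2 \<and> (\<exists>x. hom_solution M x \<and> invertible_mat (V_mat n x))"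
    if "similar_families n r A B"
  proof -
    from that obtain T where T: "T \<in> GL n" and sim: "\<And>i. i \<in> {1..r} \<Longrightarrow> A i = T * B i * mat_inv T"
      by (auto simp: similar_families_def)
    obtain T' where T': "T' \<in> carrier_mat n n" "T * T' = 1\<^sub>m n" "T' * T = 1\<^sub>m n"
      using GL_obtain_inverse[OF T] .
    have Tc: "T \<in> carrier_mat n n" using T by (simp add: GL_def)
    \<comment> \<open>From \<open>A\<^sub>i = T B\<^sub>i T\<inverse>\<close> it is \<open>T\<inverse>\<close>, not \<open>T\<close>, that intertwines, so \<open>x\<close> lists the entries of \<open>T\<inverse>\<close>.\<close>
    define x where "x = vec (n * n) (\<lambda>j. T' $$ (j div n, j mod n))"
    have idx: "i * n + j < n * n" if "i < n" "j < n" for i j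
      using mult_le_mono1[of "Suc i" n n] that by simp
    have Vx: "V_mat n x = T'" using T'(1) by (auto simp: V_mat_def x_def idx)
    have "T' * A i = B i * T'" if i: "i \<in> {1..r}" for i
    proof -
      have Bi: "B i \<in> carrier_mat n n" using assms(3) i .
      have BT: "B i * T' \<in> carrier_mat n n" using Bi T'(1) by simp
      have "A i = T * (B i * T')"
        using assoc_mult_mat[OF Tc Bi T'(1)] by (simp add: sim[OF i] mat_inv_eqI[OF Tc T'(1,2)])
      then have "T' * A i = T' * T * (B i * T')" by (simp only: assoc_mult_mat[OF T'(1) Tc BT])
      then show ?thesis using left_mult_one_mat[OF BT] by (simp only: T'(3))
    qed
    then have "\<forall>i\<in>{1..r}. V_mat n x * A i = B i * V_mat n x" unfolding Vx by blast
    moreover have "x \<in> carrier_vec (n * n)" by (simp add: x_def)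
    ultimately have x: "hom_solution M x" unfolding sol by blast
    have "x \<noteq> 0\<^sub>v (n * n)"
    proof
      assume "x = 0\<^sub>v (n * n)"
      then have "T' = 0\<^sub>m n n" unfolding Vx[symmetric] by (auto simp: V_mat_def idx)
      then have "1\<^sub>m n = (0\<^sub>m n n :: complex mat)" using T'(2) right_mult_zero_mat[OF Tc, of n] by simp
      then have "1\<^sub>m n $$ (0,0) = (0\<^sub>m n n :: complex mat) $$ (0,0)" by simp
      then show False using \<open>n \<ge> 1\<close> by simp
    qed
    then have "mat_rank M < n * n"
      using x dim_M
      by (intro rank_less_if_kernel_nontrivial[of _ _ _ x]) (auto simp: hom_solution_def)
    moreover have "invertible_mat (V_mat n x)"
      unfolding Vx by (rule invertible_matI[OF T'(1) Tc T'(3,2)])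
    ultimately show ?thesis using x by (auto simp: power2_eq_square)
  qed
  show ?thesis using recover similar solvable by blast
qed

end
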